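(* Let $n\ge1$ and $\mathbf{x}=(x_0,\ldots,x_n)\in E^{n+1}$, with $E\subseteq\mathbb{R}^d$. Consider two transition probabilities $\Pi$ and $\hat\Pi$ on $E$. Let $\mathcal{A}$ be a collection of Borel subsets of $\mathbb{R}^d$ and suppose that the statistical depth $D$ satisfies the following Lipschitz condition: there exists a finite constant $C_d$ such that, for any probability distributions $P$ and $Q$ on $\mathbb{R}^d$, $$\sup_{x\in\mathbb{R}^d}|D_P(x)-D_Q(x)|\le C_d\|P-Q\|_{\mathcal{A}}.$$ Suppose also that there exists $\epsilon>0$ such that $\min\{D_{\hat\Pi_{x_i}}(x_{i+1}),D_{\Pi_{x_i}}(x_{i+1})\}>\epsilon$ for all $i\in\{0,\ldots,n-1\}$. Then $$|D_\Pi(\mathbf{x})-D_{\hat\Pi}(\mathbf{x})|\le\frac74\,C_d\,\frac{D_\Pi(\mathbf{x})}{\epsilon}\max_{i=0,\ldots,n-1}\|\Pi_{x_i}-\hat\Pi_{x_i}\|_{\mathcal{A}}.$$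
   Context: A statistical depth $D$ assigns to every probability distribution $P$ on $\mathbb{R}^d$ a bounded non-negative Borel function $D_P:\mathbb{R}^d\to\mathbb{R}_+$. Distributions on $E$ are viewed as distributions on $\mathbb{R}^d$. A transition probability on $E$ is a kernel $(x,A)\in E\times\mathcal{B}(E)\mapsto\Pi_x(A)$. For probability distributions $P,Q$ on $\mathbb{R}^d$, $\|P-Q\|_{\mathcal{A}}:=\sup_{A\in\mathcal{A}}|P(A)-Q(A)|$. Markovian sample path depth: for $n\ge1$ and $\mathbf{x}=(x_0,\ldots,x_n)\in E^{n+1}$, $D_\Pi(\mathbf{x})=\left(\prod_{i=1}^nD_{\Pi_{x_{i-1}}}(x_i)\right)^{1/n}$, with the convention $\sqrt[n]{0}=0$. *)

theory Defs
  imports "HOL-Probability.Probability"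
begin

definition statistical_depth :: "((real^'d) measure \<Rightarrow> real^'d \<Rightarrow> real) \<Rightarrow> bool" where
  "statistical_depth D \<longleftrightarrow>
     (\<forall>P \<in> space (prob_algebra borel).
        bounded (range (D P)) \<and> (\<forall>x. 0 \<le> D P x) \<and> D P \<in> borel_measurable borel)"

text \<open>\<open>E\<close> carries the trace of the Borel sigma-algebra; \<open>E\<close> itself need not be Borel.
  Measurability into \<^const>\<open>prob_algebra\<close> says that every \<open>K x\<close> with \<open>x \<in> E\<close> is a probability
  measure on \<open>E\<close> and that \<open>x \<mapsto> K x A\<close> is measurable for every measurable \<open>A\<close>.\<close>

definition transition_probability :: "(real^'d) set \<Rightarrow> (real^'d \<Rightarrow> (real^'d) measure) \<Rightarrow> bool" where
  "transition_probability E K \<longleftrightarrow>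
     K \<in> restrict_space borel E \<rightarrow>\<^sub>M prob_algebra (restrict_space borel E)"

text \<open>A distribution on \<open>E\<close> viewed on the whole space: the push-forward under the inclusion map.\<close>

definition on_whole :: "(real^'d) measure \<Rightarrow> (real^'d) measure" where
  "on_whole P = distr P borel (\<lambda>x. x)"

lemma on_whole:
  assumes "P \<in> space (prob_algebra (restrict_space borel E))"
  shows on_whole_in_prob_algebra: "on_whole P \<in> space (prob_algebra borel)"
    and emeasure_on_whole: "A \<in> sets borel \<Longrightarrow> emeasure (on_whole P) A = emeasure P (E \<inter> A)"
proof -
  have P: "prob_space P" "sets P = sets (restrict_space borel E)"
    using assms by (auto simp: space_prob_algebra)
  have sp: "space P = E"
    using sets_eq_imp_space_eq[OF P(2)] by (simp add: space_restrict_space)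
  have m: "(\<lambda>x. x) \<in> P \<rightarrow>\<^sub>M borel"
    unfolding measurable_cong_sets[OF P(2) refl]
    by (intro measurable_restrict_space1) simp
  show "on_whole P \<in> space (prob_algebra borel)"
    using P(1) m by (auto simp: on_whole_def space_prob_algebra intro: prob_space.prob_space_distr)
  show "emeasure (on_whole P) A = emeasure P (E \<inter> A)" if "A \<in> sets borel"
    using m that by (simp add: on_whole_def emeasure_distr sp Int_commute)
qed

text \<open>The quantities lie in \<open>[0,1]\<close>, so the supremum over the empty collection is \<open>0\<close>;
  the real \<^const>\<open>Sup\<close> is unspecified there.\<close>

definition dist_on :: "(real^'d) set set \<Rightarrow> (real^'d) measure \<Rightarrow> (real^'d) measure \<Rightarrow> real" where
  "dist_on \<A> P Q =
     (if \<A> = {} then 0 else (SUP A\<in>\<A>. \<bar>measure P A - measure Q A\<bar>))"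

definition path_depth ::
  "((real^'d) measure \<Rightarrow> real^'d \<Rightarrow> real) \<Rightarrow> (real^'d \<Rightarrow> (real^'d) measure) \<Rightarrow> nat
     \<Rightarrow> (nat \<Rightarrow> real^'d) \<Rightarrow> real" where
  "path_depth D K n x = root n (\<Prod>i=1..n. D (on_whole (K (x (i - 1)))) (x i))"

end

theory Submission imports Defs
begin

text \<open>
  Write \<open>a\<^sub>i\<close> and \<open>b\<^sub>i\<close> for the depths of \<open>x\<^sub>i\<close> under the two transition laws started
  at the preceding point, \<open>d\<^sub>i\<close> for the distance of these laws, and \<open>t = C \<cdot> max\<^sub>i d\<^sub>i\<close>. The
  Lipschitz condition gives \<open>\<bar>a\<^sub>i - b\<^sub>i\<bar> \<le> t\<close>. All depths exceed \<open>\<epsilon>\<close>, so this absolute error is a relative one: with \<open>u = t / \<epsilon>\<close>,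
  \<open>a\<^sub>i \<le> b\<^sub>i + t \<le> (1 + u) b\<^sub>i\<close> and likewise \<open>b\<^sub>i \<le> (1 + u) a\<^sub>i\<close>.
  Relative bounds pass through geometric means with the same factor
  (\<open>root_prod_le\<close>). Hence the path depths \<open>A\<close> and \<open>B\<close> satisfy \<open>A \<le> (1 + u) B\<close> and
  \<open>B \<le> (1 + u) A\<close>, which forces \<open>\<bar>A - B\<bar> \<le> u A\<close>, whatever the size of \<open>u\<close>
  (\<open>abs_root_prod_diff_le\<close>). This argument yields the estimate with the constant \<open>1\<close>, better than \<open>7/4\<close>.

  The sign of \<open>C\<close> is unrestricted. A negative \<open>C\<close> is compatible with the Lipschitz
  condition only if all distances vanish, and therefore \<open>C \<cdot> d\<^sub>i \<le> t\<close> in every case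
  (\<open>scaled_le_scaled_Max\<close>).
\<close>

lemma root_prod_le:
  fixes a b :: "'i \<Rightarrow> real"
  assumes "card I > 0" and "c \<ge> 0"
    and "\<And>i. i \<in> I \<Longrightarrow> 0 \<le> a i" and "\<And>i. i \<in> I \<Longrightarrow> a i \<le> c * b i"
  shows "root (card I) (\<Prod>i\<in>I. a i) \<le> c * root (card I) (\<Prod>i\<in>I. b i)"
proof -
  have "(\<Prod>i\<in>I. a i) \<le> (\<Prod>i\<in>I. c * b i)"
    using assms(3,4) by (intro prod_mono) auto
  also have "\<dots> = c ^ card I * (\<Prod>i\<in>I. b i)"
    by (simp add: prod.distrib)
  finally have "root (card I) (\<Prod>i\<in>I. a i) \<le> root (card I) (c ^ card I * (\<Prod>i\<in>I. b i))"
    using assms(1) by simp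
  also have "\<dots> = c * root (card I) (\<Prod>i\<in>I. b i)"
    using assms(1,2) by (simp add: real_root_mult real_root_power_cancel)
  finally show ?thesis .
qed

text \<open>The hypothesis bounds the absolute error by \<open>t\<close>; the lower bound \<open>\<epsilon>\<close> on all factors turns it
  into the relative error \<open>t / \<epsilon>\<close>, the form that geometric means preserve.\<close>

lemma abs_root_prod_diff_le:
  fixes a b :: "'i \<Rightarrow> real"
  assumes card: "card I > 0" and "\<epsilon> > 0"
    and a: "\<And>i. i \<in> I \<Longrightarrow> \<epsilon> \<le> a i" and b: "\<And>i. i \<in> I \<Longrightarrow> \<epsilon> \<le> b i"
    and diff: "\<And>i. i \<in> I \<Longrightarrow> \<bar>a i - b i\<bar> \<le> t"
  shows "\<bar>root (card I) (\<Prod>i\<in>I. a i) - root (card I) (\<Prod>i\<in>I. b i)\<bar>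
           \<le> t / \<epsilon> * root (card I) (\<Prod>i\<in>I. a i)"
proof -
  define u where "u = t / \<epsilon>"
  define A where "A = root (card I) (\<Prod>i\<in>I. a i)"
  define B where "B = root (card I) (\<Prod>i\<in>I. b i)"
  obtain i where "i \<in> I"
    using card by fastforce
  then have "t \<ge> 0"
    using diff[of i] by linarith
  then have u: "u \<ge> 0"
    using \<open>\<epsilon> > 0\<close> by (simp add: u_def)
  have t_le: "t \<le> u * z" if "\<epsilon> \<le> z" for z
    using mult_left_mono[OF that u] \<open>\<epsilon> > 0\<close> by (simp add: u_def)
  have "a i \<le> (1 + u) * b i" "b i \<le> (1 + u) * a i" if "i \<in> I" for i
    using diff[OF that] t_le[OF a[OF that]] t_le[OF b[OF that]] by (auto simp: distrib_right)
  moreover have "0 \<le> a i" "0 \<le> b i" if "i \<in> I" for i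
    using a[OF that] b[OF that] \<open>\<epsilon> > 0\<close> by auto
  ultimately have AB: "A \<le> (1 + u) * B" "B \<le> (1 + u) * A" and "A \<ge> 0"
    using u card unfolding A_def B_def by (auto intro!: root_prod_le prod_nonneg)
  have "\<bar>A - B\<bar> \<le> u * A"
  proof (cases "B \<le> A")
    case True
    then have "u * B \<le> u * A"
      using u by (rule mult_left_mono)
    then show ?thesis
      using AB True by (simp add: distrib_right)
  next
    case False
    then show ?thesis
      using AB by (simp add: distrib_right)
  qed
  then show ?thesis
    by (simp add: A_def B_def u_def)
qed

text \<open>This serves to replace each \<open>C \<cdot> d\<^sub>i\<close> by the common bound \<open>t\<close>. Multiplication by a
  negative \<open>c\<close> reverses order, but then \<open>0 \<le> d j\<close> and \<open>0 \<le> c * d j\<close> leave only \<open>d j = 0\<close>.\<close>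

lemma scaled_le_scaled_Max:
  fixes d :: "'i \<Rightarrow> real"
  assumes "finite I" and "i \<in> I"
    and "\<And>j. j \<in> I \<Longrightarrow> 0 \<le> d j" and "\<And>j. j \<in> I \<Longrightarrow> 0 \<le> c * d j"
  shows "c * d i \<le> c * (MAX j\<in>I. d j)"
proof (cases "c \<ge> 0")
  case True
  then show ?thesis
    using assms(1,2) by (intro mult_left_mono Max_ge) auto
next
  case False
  then have "d j = 0" if "j \<in> I" for j
    using assms(3,4)[OF that] by (simp add: zero_le_mult_iff)
  then have "d ` I = {0}"
    using assms(2) by force
  then show ?thesis
    using \<open>\<And>j. j \<in> I \<Longrightarrow> d j = 0\<close> assms(2) by simp
qed

lemma dist_on_nonneg:
  assumes "P \<in> space (prob_algebra borel)" and "Q \<in> space (prob_algebra borel)"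
  shows "dist_on \<A> P Q \<ge> 0"
proof (cases "\<A> = {}")
  case True
  then show ?thesis
    by (simp add: dist_on_def)
next
  case False
  then obtain A where A: "A \<in> \<A>"
    by blast
  have "prob_space P" "prob_space Q"
    using assms by (auto simp: space_prob_algebra)
  then have le1: "measure P B \<le> 1" "measure Q B \<le> 1" for B
    by (auto simp: prob_space.prob_le_1)
  have "\<bar>measure P B - measure Q B\<bar> \<le> 1" for B
    using le1[of B] measure_nonneg[of P B] measure_nonneg[of Q B] by linarith
  then have "bdd_above ((\<lambda>B. \<bar>measure P B - measure Q B\<bar>) ` \<A>)"
    by (auto simp: bdd_above_def)
  then have "\<bar>measure P A - measure Q A\<bar> \<le> dist_on \<A> P Q"
    using A False by (auto simp: dist_on_def intro: cSUP_upper)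
  then show ?thesis
    by linarith
qed

text \<open>The real supremum controls its terms only over a set that is bounded above; for the gap between two
  depth functions this is what the boundedness of depths provides.\<close>

lemma depth_diff_le_SUP:
  assumes "statistical_depth D"
    and "P \<in> space (prob_algebra borel)" and "Q \<in> space (prob_algebra borel)"
  shows "\<bar>D P z - D Q z\<bar> \<le> (SUP y. \<bar>D P y - D Q y\<bar>)"
proof -
  have "bounded (range (D P))" "bounded (range (D Q))"
    using assms by (auto simp: statistical_depth_def)
  then obtain p q where "\<And>y. \<bar>D P y\<bar> \<le> p" "\<And>y. \<bar>D Q y\<bar> \<le> q"
    unfolding bounded_iff by auto
  then have "\<bar>D P y - D Q y\<bar> \<le> p + q" for y
    by (meson abs_triangle_ineq4 add_mono order_trans)
  then have "bdd_above (range (\<lambda>y. \<bar>D P y - D Q y\<bar>))"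
    by (auto simp: bdd_above_def)
  then show ?thesis
    by (intro cSUP_upper) auto
qed

lemma transition_probability_on_whole:
  assumes "transition_probability E K" and "y \<in> E"
  shows "on_whole (K y) \<in> space (prob_algebra borel)"
proof -
  have "K y \<in> space (prob_algebra (restrict_space borel E))"
    using assms unfolding transition_probability_def
    by (elim measurable_space) (simp add: space_restrict_space)
  then show ?thesis
    by (rule on_whole_in_prob_algebra)
qed

theorem theorem3:
  fixes E :: "(real^'d) set"
    and D :: "(real^'d) measure \<Rightarrow> real^'d \<Rightarrow> real"
    and K K' :: "real^'d \<Rightarrow> (real^'d) measure"
    and \<A> :: "(real^'d) set set"
    and x :: "nat \<Rightarrow> real^'d"
    and n :: nat
    and C \<epsilon> :: real
  assumes "n \<ge> 1"
    and "\<And>i. i \<le> n \<Longrightarrow> x i \<in> E"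
    and "transition_probability E K"
    and "transition_probability E K'"
    and "\<A> \<subseteq> sets borel"
    and "statistical_depth D"
    and "\<And>P Q. P \<in> space (prob_algebra borel) \<Longrightarrow> Q \<in> space (prob_algebra borel) \<Longrightarrow>
           (SUP y. \<bar>D P y - D Q y\<bar>) \<le> C * dist_on \<A> P Q"
    and "\<epsilon> > 0"
    and "\<And>i. i \<in> {0..n - 1} \<Longrightarrow>
           min (D (on_whole (K' (x i))) (x (i + 1))) (D (on_whole (K (x i))) (x (i + 1))) > \<epsilon>"
  shows "\<bar>path_depth D K n x - path_depth D K' n x\<bar>
           \<le> 7 / 4 * C * (path_depth D K n x / \<epsilon>)
             * (MAX i\<in>{0..n - 1}. dist_on \<A> (on_whole (K (x i))) (on_whole (K' (x i))))"
proof -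
  define P where "P i = on_whole (K (x i))" for i
  define Q where "Q i = on_whole (K' (x i))" for i
  define d where "d i = dist_on \<A> (P i) (Q i)" for i
  define t where "t = C * (MAX i\<in>{0..n - 1}. d i)"
  have PQ: "P i \<in> space (prob_algebra borel)" "Q i \<in> space (prob_algebra borel)"
    if "i \<le> n" for i
    using transition_probability_on_whole assms(2-4) that unfolding P_def Q_def by blast+
  have Lipschitz: "\<bar>D (P i) z - D (Q i) z\<bar> \<le> C * d i" if "i \<le> n" for i z
    using depth_diff_le_SUP[OF assms(6) PQ[OF that], of z] assms(7)[OF PQ[OF that]]
    unfolding d_def by linarith
  have "0 \<le> d i" "0 \<le> C * d i" if "i \<le> n" for i
    using dist_on_nonneg[OF PQ[OF that]] Lipschitz[OF that, of 0] by (auto simp: d_def)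
  then have "C * d i \<le> t" if "i \<in> {0..n - 1}" for i
    unfolding t_def using that by (intro scaled_le_scaled_Max) auto
  then have diff: "\<bar>D (P (i - 1)) (x i) - D (Q (i - 1)) (x i)\<bar> \<le> t" if "i \<in> {1..n}" for i
  proof -
    have "i - 1 \<le> n" "i - 1 \<in> {0..n - 1}"
      using that by auto
    then show ?thesis
      using Lipschitz \<open>\<And>i. i \<in> {0..n - 1} \<Longrightarrow> C * d i \<le> t\<close> order_trans by blast
  qed
  have "\<epsilon> \<le> D (P (i - 1)) (x i) \<and> \<epsilon> \<le> D (Q (i - 1)) (x i)" if "i \<in> {1..n}" for i
    using assms(9)[of "i - 1"] that diff_le_mono[of i n 1] by (auto simp: P_def Q_def)
  then have "\<bar>path_depth D K n x - path_depth D K' n x\<bar> \<le> t / \<epsilon> * path_depth D K n x"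
    using abs_root_prod_diff_le[of "{1..n}" \<epsilon> "\<lambda>i. D (P (i - 1)) (x i)" "\<lambda>i. D (Q (i - 1)) (x i)" t]
      assms(1,8) diff by (simp add: path_depth_def P_def Q_def)
  \<comment> \<open>The right-hand side dominates an absolute value, hence is nonnegative and can be enlarged by
    the factor \<open>7/4\<close>.\<close>
  moreover have "r \<le> 7 / 4 * s" if "0 \<le> r" "r \<le> s" for r s :: real
    using that by linarith
  ultimately have "\<bar>path_depth D K n x - path_depth D K' n x\<bar> \<le> 7 / 4 * (t / \<epsilon> * path_depth D K n x)"
    by (meson abs_ge_zero)
  then show ?thesis
    by (simp add: t_def d_def P_def Q_def mult_ac)
qed

end
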